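(* Let $n\ge 2$ be an integer, let $0<\gamma_1,\gamma_2<1$, let $c_6>0$ be a fixed constant, and let $\mathbf{d}=(d_1,d_2)\in\mathbb{R}^2$ with $d_1\ne d_2$. For $Q>1$ let $\Pi=I_1\times I_2\subset\mathbb{R}^2$ be the rectangle with midpoint $\mathbf{d}$ whose sides are intervals of lengths $\mu_1 I_i=c_6Q^{-\gamma_i}$, $i=1,2$. Then there is $Q_0=Q_0(n,\gamma_1,\gamma_2,\mathbf{d})$ such that for all $Q>Q_0$ $$\#\left(\tilde{\mathbb{A}}_n^2(Q)\cap\Pi\right)<c_7\,Q^{n}\mu_2\Pi,$$ where $$c_7=2^{3n+8}n^2\rho_n(d_1)\rho_n(d_2)\,|d_1-d_2|^{-1},\qquad \rho_n(x)=\frac{(|x|+1)^{n+1}-1}{|x|}$$ (with $\rho_n(0)=n+1$).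
   Context: The height $H(P)$ of a polynomial $P\in\mathbb{Z}[t]$ is the maximum of the absolute values of its coefficients. An algebraic integer point is a point $\boldsymbol{\alpha}=(\alpha_1,\alpha_2)$ whose coordinates are roots of the same monic polynomial $P\in\mathbb{Z}[t]$ that is irreducible over $\mathbb{Q}$; $P$ is the minimal polynomial of $\boldsymbol{\alpha}$, and $\deg\boldsymbol{\alpha}:=\deg P$, $H(\boldsymbol{\alpha}):=H(P)$. $\tilde{\mathbb{A}}_n^2(Q)$ denotes the set of algebraic integer points $\boldsymbol{\alpha}$ with $\deg\boldsymbol{\alpha}=n$ and $H(\boldsymbol{\alpha})\le Q$. $\mu_k$ is Lebesgue measure on $\mathbb{R}^k$ and $\#S$ is the cardinality of a finite set $S$. The constant $c_6$ is independent of $Q$ and fixed in advance; $Q_0$ may also depend on it. *)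

theory Defs
  imports "HOL-Analysis.Analysis" "HOL-Computational_Algebra.Polynomial_Factorial"
    "HOL-Computational_Algebra.Field_as_Ring"
begin

definition poly_height :: "int poly \<Rightarrow> int" where
  "poly_height P = Max ((\<lambda>i. \<bar>coeff P i\<bar>) ` {..degree P})"

definition is_min_poly :: "real \<times> real \<Rightarrow> int poly \<Rightarrow> bool" where
  "is_min_poly \<alpha> P \<longleftrightarrow>
     lead_coeff P = 1 \<and> irreducible (map_poly of_int P :: rat poly) \<and>
     poly (map_poly of_int P) (fst \<alpha>) = 0 \<and> poly (map_poly of_int P) (snd \<alpha>) = 0"

definition alg_int_point :: "real \<times> real \<Rightarrow> bool" where
  "alg_int_point \<alpha> \<longleftrightarrow> (\<exists>P. is_min_poly \<alpha> P)"

lemma is_min_poly_unique: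
  assumes "is_min_poly \<alpha> P" "is_min_poly \<alpha> R"
  shows "P = R"
proof -
  define p q :: "rat poly" where "p = map_poly of_int P" and "q = map_poly of_int R"
  define ev :: "rat poly \<Rightarrow> real" where "ev f = poly (map_poly of_rat f) (fst \<alpha>)" for f
  have ev_pCons: "ev (pCons a f) = of_rat a + fst \<alpha> * ev f" for a f
    by (simp add: ev_def map_poly_pCons)
  have ev_0: "ev 0 = 0" and ev_1: "ev 1 = 1" by (simp_all add: ev_def)
  have ev_add: "ev (f + g) = ev f + ev g" for f g
    by (induction f g rule: poly_induct2) (simp_all add: ev_0 ev_pCons of_rat_add algebra_simps)
  have ev_smult: "ev (smult a f) = of_rat a * ev f" for a f
    by (induction f) (simp_all add: ev_0 ev_pCons of_rat_mult algebra_simps)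
  have ev_mult: "ev (f * g) = ev f * ev g" for f g
    by (induction f) (simp_all add: ev_0 ev_pCons ev_add ev_smult algebra_simps)
  have irr: "irreducible p" "irreducible q"
    using assms by (auto simp: is_min_poly_def p_def q_def)
  have lc: "lead_coeff p = 1" "lead_coeff q = 1"
    using assms by (auto simp: is_min_poly_def p_def q_def coeff_map_poly degree_map_poly)
  have root: "ev p = 0" "ev q = 0"
    using assms by (auto simp: is_min_poly_def p_def q_def ev_def map_poly_map_poly o_def)
  have "\<not> coprime p q"
  proof
    assume "coprime p q"
    then have "fst (bezout_coefficients p q) * p + snd (bezout_coefficients p q) * q = 1"
      by (simp only: bezout_coefficients_fst_snd coprime_iff_gcd_eq_1)
    from arg_cong[OF this, of ev] show False
      by (simp add: ev_add ev_mult ev_1 root)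
  qed
  then have "p dvd q"
    using field_poly_irreducible_imp_prime[OF irr(1)] prime_elem_imp_coprime by blast
  moreover have "q dvd p"
    using irreducibleD'[OF irr(2) \<open>p dvd q\<close>] irreducible_not_unit[OF irr(1)] by blast
  moreover have "normalize p = p" "normalize q = q"
    by (rule poly_eqI, simp only: coeff_normalize lc unit_factor_1 div_by_1)+
  ultimately have "p = q"
    by (rule associated_eqI)
  then have "(of_int (coeff P i) :: rat) = of_int (coeff R i)" for i
    unfolding p_def q_def by (auto simp: poly_eq_iff coeff_map_poly)
  then show ?thesis by (simp add: poly_eq_iff)
qed

definition min_poly :: "real \<times> real \<Rightarrow> int poly" where
  "min_poly \<alpha> = (THE P. is_min_poly \<alpha> P)"

lemma min_poly_eq: "is_min_poly \<alpha> P \<Longrightarrow> min_poly \<alpha> = P"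
  unfolding min_poly_def using is_min_poly_unique by blast

definition point_degree :: "real \<times> real \<Rightarrow> nat" where
  "point_degree \<alpha> = degree (min_poly \<alpha>)"

definition point_height :: "real \<times> real \<Rightarrow> int" where
  "point_height \<alpha> = poly_height (min_poly \<alpha>)"

definition alg_int_points :: "nat \<Rightarrow> real \<Rightarrow> (real \<times> real) set" where
  "alg_int_points n Q =
     {\<alpha>. alg_int_point \<alpha> \<and> point_degree \<alpha> = n \<and> of_int (point_height \<alpha>) \<le> Q}"

text \<open>The interval may be open, closed or half-open; only its midpoint and length are prescribed.\<close>

definition interval_centred :: "real \<Rightarrow> real \<Rightarrow> real set \<Rightarrow> bool" where
  "interval_centred m l I \<longleftrightarrow>
     is_interval I \<and> bounded I \<and> (Inf I + Sup I) / 2 = m \<and> measure lborel I = l"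

definition rho :: "nat \<Rightarrow> real \<Rightarrow> real" where
  "rho n x = (if x = 0 then of_nat n + 1 else ((\<bar>x\<bar> + 1) ^ (n + 1) - 1) / \<bar>x\<bar>)"

definition c7 :: "nat \<Rightarrow> real \<Rightarrow> real \<Rightarrow> real" where
  "c7 n d1 d2 = 2 ^ (3 * n + 8) * (of_nat n)\<^sup>2 * rho n d1 * rho n d2 * inverse \<bar>d1 - d2\<bar>"

end

theory Submission
  imports Defs "HOL-Real_Asymp.Real_Asymp"
begin

text \<open>
  A monic \<open>P\<close> of degree \<open>n\<close> and height at most \<open>Q\<close> with a root in each of \<open>I1\<close>, \<open>I2\<close> satisfies
  \<open>\<bar>P(d\<^sub>i)\<bar> \<le> H\<^sub>i\<close> with \<open>H\<^sub>i\<close> of order \<open>Q \<bar>I\<^sub>i\<bar>\<close>. Once the coefficients of degree \<open>2, \<dots>, n - 1\<close> are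
  fixed, in at most \<open>(3 Q)\<^bsup>n - 2\<^esup>\<close> ways, the pair of the constant and the linear coefficient is a
  lattice point of a parallelogram of area \<open>4 H\<^sub>1 H\<^sub>2 / \<bar>d\<^sub>1 - d\<^sub>2\<bar>\<close>. Since \<open>\<gamma>\<^sub>i < 1\<close>, both \<open>H\<^sub>i\<close> tend to
  infinity, so the number of lattice points is at most a constant multiple of this area. Each
  polynomial accounts for at most \<open>n\<^sup>2\<close> points.
\<close>

section \<open>Lattice points in a parallelogram\<close>

lemma card_int_near:
  fixes c r :: real
  assumes "r \<ge> 0"
  shows "finite {k::int. \<bar>of_int k - c\<bar> \<le> r}"
    and "real (card {k::int. \<bar>of_int k - c\<bar> \<le> r}) \<le> 2 * r + 1"
proof -
  have eq: "{k::int. \<bar>of_int k - c\<bar> \<le> r} = {\<lceil>c - r\<rceil>..\<lfloor>c + r\<rfloor>}"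
    by (auto simp: abs_le_iff ceiling_le_iff le_floor_iff)
  show "finite {k::int. \<bar>of_int k - c\<bar> \<le> r}"
    unfolding eq by simp
  show "real (card {k::int. \<bar>of_int k - c\<bar> \<le> r}) \<le> 2 * r + 1"
    unfolding eq using assms by simp linarith
qed

text \<open>Subtracting the two inequalities eliminates \<open>a\<close> and confines
  \<open>b\<close> to a window of half-width \<open>(H1 + H2) / \<bar>d1 - d2\<bar>\<close>. For
  each such \<open>b\<close> the second inequality leaves a window of half-width \<open>H2\<close>
  for \<open>a\<close>. Slicing by the smaller bound \<open>H2\<close> matters: the first window is
  then of order \<open>H1\<close>, and the product is of the order of the area.\<close>

lemma card_lattice_parallelogram_le_of_le:
  fixes d1 d2 u1 u2 H1 H2 :: real
  assumes "d1 \<noteq> d2" "1 \<le> H2" "H2 \<le> H1" "\<bar>d1 - d2\<bar> \<le> 4 * H1"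
  defines "T \<equiv> {(a::int, b::int). \<bar>of_int a + of_int b * d1 + u1\<bar> \<le> H1 \<and>
                 \<bar>of_int a + of_int b * d2 + u2\<bar> \<le> H2}"
  shows "finite T" and "real (card T) \<le> 24 * H1 * H2 / \<bar>d1 - d2\<bar>"
proof -
  define \<delta> where "\<delta> = \<bar>d1 - d2\<bar>"
  have \<delta>: "\<delta> > 0" using assms by (simp add: \<delta>_def)
  define r where "r = (H1 + H2) / \<delta>"
  define B where "B = {b::int. \<bar>of_int b - (u2 - u1) / (d1 - d2)\<bar> \<le> r}"
  define A where "A b = {a::int. \<bar>of_int a - (- of_int b * d2 - u2)\<bar> \<le> H2}" for b :: int
  have "r \<ge> 0" using assms \<delta> by (simp add: r_def)
  have finB: "finite B" and cardB: "real (card B) \<le> 2 * r + 1"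
    unfolding B_def using card_int_near[OF \<open>r \<ge> 0\<close>] by auto
  have finA: "finite (A b)" and cardA: "real (card (A b)) \<le> 2 * H2 + 1" for b
    unfolding A_def using assms card_int_near[of H2] by auto
  have sub: "T \<subseteq> (\<lambda>(b, a). (a, b)) ` Sigma B A"
  proof clarify
    fix a b :: int
    assume "(a, b) \<in> T"
    then have h: "\<bar>of_int a + of_int b * d1 + u1\<bar> \<le> H1" "\<bar>of_int a + of_int b * d2 + u2\<bar> \<le> H2"
      by (auto simp: T_def)
    have "\<bar>of_int b * (d1 - d2) - (u2 - u1)\<bar> \<le> H1 + H2"
      using h by (simp add: algebra_simps abs_le_iff)
    moreover have "of_int b - (u2 - u1) / (d1 - d2) = (of_int b * (d1 - d2) - (u2 - u1)) / (d1 - d2)"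
      using assms by (simp add: field_simps)
    ultimately have "b \<in> B"
      using \<delta> by (simp add: B_def r_def abs_divide divide_right_mono flip: \<delta>_def)
    moreover have "a \<in> A b"
      using h by (simp add: A_def algebra_simps)
    ultimately show "(a, b) \<in> (\<lambda>(b, a). (a, b)) ` Sigma B A" by force
  qed
  have finS: "finite (Sigma B A)" using finA finB by auto
  then show "finite T" using sub finite_subset by blast
  have "card T \<le> card (Sigma B A)"
    using sub finS by (meson card_image_le card_mono finite_imageI le_trans)
  also have "\<dots> = (\<Sum>b\<in>B. card (A b))"
    using finA finB by simp
  finally have "real (card T) \<le> (\<Sum>b\<in>B. real (card (A b)))"
    by (metis of_nat_le_iff of_nat_sum)
  also have "\<dots> \<le> real (card B) * (2 * H2 + 1)"
    using sum_bounded_above[of B "\<lambda>b. real (card (A b))"] cardA by blast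
  also have "\<dots> \<le> (2 * r + 1) * (2 * H2 + 1)"
    using cardB assms by (intro mult_right_mono) auto
  also have "\<dots> \<le> (8 * H1 / \<delta>) * (3 * H2)"
  \<comment> \<open>The lower bounds on \<open>H1\<close> and \<open>H2\<close> absorb both summands
    1 coming from the counts of integers: \<open>2 * r\<close> and 1 are each at most
    \<open>4 * H1 / \<delta>\<close>, and \<open>2 * H2 + 1 \<le> 3 * H2\<close>. Hence 8 * 3 =
    24.\<close>
  proof (rule mult_mono)
    have "r \<le> 2 * H1 / \<delta>" "1 \<le> 4 * H1 / \<delta>"
      using assms \<delta> by (simp_all add: r_def divide_right_mono flip: \<delta>_def)
    then show "2 * r + 1 \<le> 8 * H1 / \<delta>" by simp
  qed (use assms \<delta> in auto)
  finally show "real (card T) \<le> 24 * H1 * H2 / \<bar>d1 - d2\<bar>"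
    by (simp add: \<delta>_def)
qed

text \<open>The two conditions are symmetric, so the ordering of \<open>H1\<close> and
  \<open>H2\<close> is removed by exchanging them.\<close>

lemma card_lattice_parallelogram_le:
  fixes d1 d2 u1 u2 H1 H2 :: real
  assumes "d1 \<noteq> d2" "1 \<le> H1" "1 \<le> H2" "\<bar>d1 - d2\<bar> \<le> 4 * H1" "\<bar>d1 - d2\<bar> \<le> 4 * H2"
  defines "T \<equiv> {(a::int, b::int). \<bar>of_int a + of_int b * d1 + u1\<bar> \<le> H1 \<and>
                 \<bar>of_int a + of_int b * d2 + u2\<bar> \<le> H2}"
  shows "finite T" and "real (card T) \<le> 24 * H1 * H2 / \<bar>d1 - d2\<bar>"
proof -
  have "finite T \<and> real (card T) \<le> 24 * H1 * H2 / \<bar>d1 - d2\<bar>"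
  proof (cases "H2 \<le> H1")
    case True
    then show ?thesis
      unfolding T_def using card_lattice_parallelogram_le_of_le[of d1 d2 H2 H1 u1 u2] assms by blast
  next
    case False
    then show ?thesis
      unfolding T_def
      using card_lattice_parallelogram_le_of_le[of d2 d1 H1 H2 u2 u1] assms
      by (simp add: abs_minus_commute conj_commute mult.commute mult.left_commute)
  qed
  then show "finite T" "real (card T) \<le> 24 * H1 * H2 / \<bar>d1 - d2\<bar>" by auto
qed

section \<open>Size of a polynomial near one of its roots\<close>

lemma rho_eq_sum: "rho n x = (\<Sum>k\<le>n. (\<bar>x\<bar> + 1) ^ k)"
proof (cases "x = 0")
  case False
  then show ?thesis
    using geometric_sum[of "\<bar>x\<bar> + 1" "Suc n"] by (simp add: rho_def lessThan_Suc_atMost)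
qed (simp add: rho_def)

lemma rho_ge_1: "rho n x \<ge> 1"
  unfolding rho_eq_sum sum.atMost_shift by (simp add: sum_nonneg)

text \<open>The cofactor of \<open>x - y\<close> in \<open>x ^ k - y ^ k\<close> has
  \<open>k\<close> terms of degree \<open>k - 1\<close>. Enlarging the exponent to \<open>k\<close>,
  allowed since \<open>B \<ge> 1\<close>, makes the later sum over \<open>k\<close> exactly
  \<open>rho\<close>.\<close>

lemma abs_power_diff_le:
  fixes x y B :: real
  assumes "\<bar>x\<bar> \<le> B" "\<bar>y\<bar> \<le> B" "1 \<le> B"
  shows "\<bar>x ^ k - y ^ k\<bar> \<le> real k * B ^ k * \<bar>x - y\<bar>"
proof -
  have "\<bar>\<Sum>i<k. y ^ (k - Suc i) * x ^ i\<bar> \<le> (\<Sum>i<k. B ^ k)"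
  proof (rule order_trans[OF sum_abs sum_mono])
    fix i assume "i \<in> {..<k}"
    have "\<bar>y ^ (k - Suc i) * x ^ i\<bar> \<le> B ^ (k - Suc i) * B ^ i"
      unfolding abs_mult power_abs using assms by (intro mult_mono power_mono) auto
    also have "\<dots> \<le> B ^ k"
      using assms \<open>i \<in> {..<k}\<close> by (simp flip: power_add add: power_increasing)
    finally show "\<bar>y ^ (k - Suc i) * x ^ i\<bar> \<le> B ^ k" .
  qed
  then have "\<bar>x - y\<bar> * \<bar>\<Sum>i<k. y ^ (k - Suc i) * x ^ i\<bar> \<le> \<bar>x - y\<bar> * (\<Sum>i<k. B ^ k)"
    by (rule mult_left_mono) simp
  then show ?thesis by (simp add: power_diff_sumr2 abs_mult mult_ac)
qed

text \<open>Since P(x) = 0, the value P(d) equals P(d) - P(x), which is estimated term by term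
  through differences of powers.\<close>

lemma abs_poly_le_of_near_root:
  fixes P :: "int poly" and x d Q :: real
  assumes deg: "degree P = n" and coeff: "\<And>i. \<bar>of_int (coeff P i)\<bar> \<le> Q"
    and root: "poly (map_poly of_int P) x = 0" and near: "\<bar>x - d\<bar> \<le> 1"
  shows "\<bar>poly (map_poly of_int P) d\<bar> \<le> Q * real n * rho n d * \<bar>x - d\<bar>"
proof -
  have Q: "Q \<ge> 0" using coeff[of 0] by linarith
  \<comment> \<open>By \<open>near\<close>, this bounds both \<open>\<bar>d\<bar>\<close> and
    \<open>\<bar>x\<bar>\<close>; it is also the ratio of the geometric sum
    \<open>rho n d\<close>.\<close>
  define B where "B = \<bar>d\<bar> + 1"
  have alt: "poly (map_poly of_int P) y = (\<Sum>k\<le>n. of_int (coeff P k) * y ^ k)" for y :: real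
    unfolding poly_altdef by (simp add: coeff_map_poly degree_map_poly deg)
  have "poly (map_poly of_int P) d = poly (map_poly of_int P) d - poly (map_poly of_int P) x"
    by (simp add: root)
  also have "\<dots> = (\<Sum>k\<le>n. of_int (coeff P k) * (d ^ k - x ^ k))"
    unfolding alt by (simp add: sum_subtractf right_diff_distrib)
  also have "\<bar>\<dots>\<bar> \<le> (\<Sum>k\<le>n. (Q * real n * \<bar>x - d\<bar>) * B ^ k)"
  proof (rule order_trans[OF sum_abs sum_mono])
    fix k assume "k \<in> {..n}"
    have "\<bar>d ^ k - x ^ k\<bar> \<le> real k * B ^ k * \<bar>d - x\<bar>"
      using near by (intro abs_power_diff_le) (auto simp: B_def)
    also have "\<dots> \<le> real n * B ^ k * \<bar>x - d\<bar>"
      using \<open>k \<in> {..n}\<close> by (auto simp: abs_minus_commute B_def intro!: mult_right_mono)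
    finally have "\<bar>of_int (coeff P k) * (d ^ k - x ^ k)\<bar> \<le> Q * (real n * B ^ k * \<bar>x - d\<bar>)"
      unfolding abs_mult using coeff Q by (intro mult_mono) auto
    then show "\<bar>of_int (coeff P k) * (d ^ k - x ^ k)\<bar> \<le> (Q * real n * \<bar>x - d\<bar>) * B ^ k"
      by (simp add: mult_ac)
  qed
  also have "\<dots> = Q * real n * rho n d * \<bar>x - d\<bar>"
    by (simp add: rho_eq_sum B_def mult_ac flip: sum_distrib_left)
  finally show ?thesis .
qed

section \<open>Monic polynomials that are small at two points\<close>

definition monic_small_at :: "nat \<Rightarrow> real \<Rightarrow> real \<Rightarrow> real \<Rightarrow> real \<Rightarrow> real \<Rightarrow> int poly set" where
  "monic_small_at n Q d1 H1 d2 H2 =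
     {P. degree P = n \<and> lead_coeff P = 1 \<and> (\<forall>i. \<bar>of_int (coeff P i)\<bar> \<le> Q) \<and>
         \<bar>poly (map_poly of_int P) d1\<bar> \<le> H1 \<and> \<bar>poly (map_poly of_int P) d2\<bar> \<le> H2}"

text \<open>The leading coefficient is 1, so only \<open>n - 2\<close> coefficients remain besides
  the constant and the linear one. With these fixed, the value at \<open>d\<close> is
  \<open>a + b * d\<close> plus a fixed offset, and the lattice point bound does not depend on the
  offset.\<close>

lemma card_monic_small_at:
  fixes Q d1 d2 H1 H2 :: real
  assumes n: "n \<ge> 2" and Q: "Q \<ge> 1"
    and H: "d1 \<noteq> d2" "1 \<le> H1" "1 \<le> H2" "\<bar>d1 - d2\<bar> \<le> 4 * H1" "\<bar>d1 - d2\<bar> \<le> 4 * H2"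
  shows "finite (monic_small_at n Q d1 H1 d2 H2)"
    and "real (card (monic_small_at n Q d1 H1 d2 H2))
           \<le> (3 * Q) ^ (n - 2) * (24 * H1 * H2 / \<bar>d1 - d2\<bar>)"
proof -
  define M where "M = monic_small_at n Q d1 H1 d2 H2"
  define F where "F = {2..<n} \<rightarrow>\<^sub>E {- \<lfloor>Q\<rfloor>..\<lfloor>Q\<rfloor>}"
  define u where "u f d = (\<Sum>k=2..<n. of_int (f k) * d ^ k) + d ^ n" for f :: "nat \<Rightarrow> int" and d :: real
  define T where "T f = {(a::int, b::int). \<bar>of_int a + of_int b * d1 + u f d1\<bar> \<le> H1 \<and>
                          \<bar>of_int a + of_int b * d2 + u f d2\<bar> \<le> H2}" for f
  \<comment> \<open>Restricting makes the tuple of middle coefficients extensional, as membership in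
    \<open>F\<close> requires. The code determines P on \<open>M\<close>, where degree and leading
    coefficient are prescribed.\<close>
  define code where "code P = (restrict (coeff P) {2..<n}, coeff P 0, coeff P 1)" for P :: "int poly"
  have finT: "finite (T f)" and cardT: "real (card (T f)) \<le> 24 * H1 * H2 / \<bar>d1 - d2\<bar>" for f
    unfolding T_def using card_lattice_parallelogram_le[OF H] by auto
  have finF: "finite F" by (auto simp: F_def intro!: finite_PiE)
  have "real (card F) = (2 * of_int \<lfloor>Q\<rfloor> + 1) ^ (n - 2)"
    using Q by (simp add: F_def card_PiE)
  also have "\<dots> \<le> (3 * Q) ^ (n - 2)"
  proof (rule power_mono)
    show "2 * of_int \<lfloor>Q\<rfloor> + 1 \<le> 3 * Q" using Q of_int_floor_le[of Q] by linarith
  qed (use Q in simp)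
  finally have cardF: "real (card F) \<le> (3 * Q) ^ (n - 2)" .
  \<comment> \<open>Here \<open>n \<ge> 2\<close> ensures that the indices 0, 1 and \<open>n\<close>
    are distinct.\<close>
  have split: "(\<Sum>k\<le>n. g k) = g 0 + g 1 + (\<Sum>k=2..<n. g k) + g n" for g :: "nat \<Rightarrow> real"
  proof -
    have "{..n} = {0, 1} \<union> {2..<n} \<union> {n}" using n by auto
    then show ?thesis using n by (simp add: sum.union_disjoint)
  qed
  have inj: "inj_on code M"
  proof (rule inj_onI, rule poly_eqI)
    fix P R i
    assume P: "P \<in> M" and R: "R \<in> M" and eq: "code P = code R"
    consider "i = 0" | "i = 1" | "i \<in> {2..<n}" | "i = n" | "i > n" by force
    then show "coeff P i = coeff R i"
    proof cases
      case 3
      then show ?thesis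
        using eq by (metis code_def fst_conv restrict_apply')
    qed (use P R eq in \<open>auto simp: code_def M_def monic_small_at_def coeff_eq_0\<close>)
  qed
  have sub: "code ` M \<subseteq> Sigma F T"
  proof (rule image_subsetI)
    fix P assume P: "P \<in> M"
    have alt: "poly (map_poly of_int P) d =
        of_int (coeff P 0) + of_int (coeff P 1) * d + u (restrict (coeff P) {2..<n}) d" for d :: real
      using P unfolding poly_altdef
      by (simp add: coeff_map_poly degree_map_poly M_def monic_small_at_def split u_def)
        auto
    have "\<bar>coeff P i\<bar> \<le> \<lfloor>Q\<rfloor>" for i
      using P by (simp add: M_def monic_small_at_def le_floor_iff)
    then have "restrict (coeff P) {2..<n} \<in> F"
      by (auto simp: F_def abs_le_iff minus_le_iff)
    moreover have "(coeff P 0, coeff P 1) \<in> T (restrict (coeff P) {2..<n})"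
      using P unfolding T_def mem_Collect_eq prod.case alt[symmetric]
      by (simp add: M_def monic_small_at_def)
    ultimately show "code P \<in> Sigma F T" by (simp add: code_def)
  qed
  have finS: "finite (Sigma F T)" using finF finT by auto
  show "finite (monic_small_at n Q d1 H1 d2 H2)"
    using finite_imageD[OF finite_subset[OF sub finS] inj] by (simp add: M_def)
  have "card M \<le> card (Sigma F T)"
    using card_inj_on_le[OF inj sub finS] .
  also have "\<dots> = (\<Sum>f\<in>F. card (T f))"
    using finF finT by simp
  finally have "real (card M) \<le> (\<Sum>f\<in>F. real (card (T f)))"
    by (metis of_nat_le_iff of_nat_sum)
  also have "\<dots> \<le> real (card F) * (24 * H1 * H2 / \<bar>d1 - d2\<bar>)"
    using sum_bounded_above[of F "\<lambda>f. real (card (T f))"] cardT by blast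
  also have "\<dots> \<le> (3 * Q) ^ (n - 2) * (24 * H1 * H2 / \<bar>d1 - d2\<bar>)"
    using cardF H by (intro mult_right_mono) auto
  finally show "real (card (monic_small_at n Q d1 H1 d2 H2))
           \<le> (3 * Q) ^ (n - 2) * (24 * H1 * H2 / \<bar>d1 - d2\<bar>)"
    by (simp add: M_def)
qed

section \<open>From polynomials to points in the rectangle\<close>

lemma abs_coeff_le_poly_height: "\<bar>coeff P i\<bar> \<le> poly_height P"
proof (cases "i \<le> degree P")
  case False
  have "0 \<le> \<bar>coeff P 0\<bar>" by simp
  also have "\<dots> \<le> poly_height P" by (auto simp: poly_height_def intro!: Max_ge)
  finally show ?thesis using False by (simp add: coeff_eq_0)
qed (auto simp: poly_height_def intro!: Max_ge)

text \<open>The open interval between infimum and supremum lies in \<open>I\<close> whichever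
  endpoints belong to it, so \<open>Sup I - Inf I\<close> is at most the measure \<open>l\<close>;
  the midpoint condition then gives the distance bound.\<close>

lemma interval_centredD:
  assumes "interval_centred m l I" "l > 0"
  shows "I \<in> sets lborel" and "measure lborel I = l"
    and "\<And>x. x \<in> I \<Longrightarrow> \<bar>x - m\<bar> \<le> l / 2"
proof -
  have int: "is_interval I" and bdd: "bounded I" and mid: "(Inf I + Sup I) / 2 = m"
    and meas: "measure lborel I = l"
    using assms by (auto simp: interval_centred_def)
  show "measure lborel I = l" by fact
  show I: "I \<in> sets lborel" using int by (simp add: real_interval_borel_measurable)
  have fin: "emeasure lborel I < \<infinity>" using bdd by (rule emeasure_bounded_finite)
  \<comment> \<open>Positive measure excludes the empty set, whose \<open>Inf\<close> and
    \<open>Sup\<close> carry no information.\<close>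
  have "I \<noteq> {}" using meas assms by auto
  have bnd: "bdd_above I" "bdd_below I"
    using bdd by (auto intro: bounded_imp_bdd_above bounded_imp_bdd_below)
  have "{Inf I<..<Sup I} \<subseteq> I"
  proof
    fix x assume "x \<in> {Inf I<..<Sup I}"
    then obtain y z where "y \<in> I" "y < x" "z \<in> I" "x < z"
      using \<open>I \<noteq> {}\<close> bnd by (auto simp: cInf_less_iff less_cSup_iff)
    then show "x \<in> I" using int by (meson is_interval_1 less_imp_le)
  qed
  then have "measure lborel {Inf I<..<Sup I} \<le> l"
    unfolding meas[symmetric] using I fin by (intro measure_mono_fmeasurable) (auto simp: fmeasurable_def)
  moreover have "Inf I \<le> Sup I" using \<open>I \<noteq> {}\<close> bnd by (rule cInf_le_cSup)
  ultimately have len: "Sup I - Inf I \<le> l" by simp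
  fix x assume "x \<in> I"
  then have "Inf I \<le> x" "x \<le> Sup I" using bnd by (auto intro: cInf_lower cSup_upper)
  moreover have "2 * m = Inf I + Sup I" using mid by simp
  ultimately show "\<bar>x - m\<bar> \<le> l / 2" using len by linarith
qed

lemma measure_lborel_Times:
  fixes A B :: "real set"
  assumes "A \<in> sets lborel" "B \<in> sets lborel"
  shows "measure lborel (A \<times> B) = measure lborel A * measure lborel B"
  using lborel.emeasure_pair_measure_Times[OF assms]
  by (simp add: measure_def lborel_prod enn2real_mult)

text \<open>The exponent is \<open>n + 1\<close> because 9 > 8 at \<open>n = 3\<close>; from
  \<open>n = 4\<close> on, induction gives the bound even with exponent \<open>n\<close>.\<close>

lemma square_le_two_power: "n\<^sup>2 \<le> (2::nat) ^ (n + 1)"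
proof (cases "n < 4")
  case True
  then have "n = 0 \<or> n = 1 \<or> n = 2 \<or> n = 3" by linarith
  then show ?thesis by auto
next
  case False
  then have "4 \<le> n" by simp
  then have "n\<^sup>2 \<le> 2 ^ n"
  proof (induction n rule: dec_induct)
    case (step m)
    have "4 * m \<le> m * m" using step(1) by (rule mult_right_mono) simp
    then have "Suc (m + m) \<le> m * m" using step(1) by linarith
    then have "(Suc m)\<^sup>2 \<le> 2 * m\<^sup>2" by (simp add: power2_eq_square)
    then show ?case using step by simp
  qed simp
  then show ?thesis by simp
qed

text \<open>Each \<open>Hi\<close> is the near-root estimate at the largest possible distance
  \<open>li / 2\<close>, and \<open>li \<le> 2\<close> keeps that distance at most 1. So the minimal
  polynomial of every point counted is small at \<open>d1\<close> and \<open>d2\<close>. Both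
  coordinates are among its at most \<open>n\<close> real roots, whence at most
  \<open>n\<^sup>2\<close> points per polynomial.\<close>

lemma card_alg_int_points_le:
  fixes Q d1 d2 H1 H2 :: real
  assumes n: "n \<ge> 2" and Q: "Q \<ge> 1"
    and H: "d1 \<noteq> d2" "1 \<le> H1" "1 \<le> H2" "\<bar>d1 - d2\<bar> \<le> 4 * H1" "\<bar>d1 - d2\<bar> \<le> 4 * H2"
    and l: "l1 \<le> 2" "l2 \<le> 2"
    and H_eq: "H1 = Q * real n * rho n d1 * (l1 / 2)" "H2 = Q * real n * rho n d2 * (l2 / 2)"
    and I: "\<And>x. x \<in> I1 \<Longrightarrow> \<bar>x - d1\<bar> \<le> l1 / 2" "\<And>x. x \<in> I2 \<Longrightarrow> \<bar>x - d2\<bar> \<le> l2 / 2"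
  shows "finite (alg_int_points n Q \<inter> (I1 \<times> I2))"
    and "real (card (alg_int_points n Q \<inter> (I1 \<times> I2)))
           \<le> (3 * Q) ^ (n - 2) * (24 * H1 * H2 / \<bar>d1 - d2\<bar>) * (real n)\<^sup>2"
proof -
  define X where "X = alg_int_points n Q \<inter> (I1 \<times> I2)"
  define M where "M = monic_small_at n Q d1 H1 d2 H2"
  define Z where "Z P = {x::real. poly (map_poly of_int P) x = 0}" for P :: "int poly"
  have Z: "finite (Z P)" "card (Z P) \<le> n" if "P \<in> M" for P
  proof -
    have deg: "degree (map_poly of_int P :: real poly) = n" and "P \<noteq> 0"
      using that n by (auto simp: M_def monic_small_at_def degree_map_poly)
    then have nz: "(map_poly of_int P :: real poly) \<noteq> 0" using n by auto
    show "finite (Z P)" unfolding Z_def using nz by (rule poly_roots_finite)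
    show "card (Z P) \<le> n" unfolding Z_def using card_poly_roots_bound[OF nz] deg by simp
  qed
  have finM: "finite M" and cardM: "real (card M) \<le> (3 * Q) ^ (n - 2) * (24 * H1 * H2 / \<bar>d1 - d2\<bar>)"
    unfolding M_def using card_monic_small_at[OF n Q H] by auto
  have sub: "X \<subseteq> (\<Union>P\<in>M. Z P \<times> Z P)"
  proof clarify
    fix x y assume xy: "(x, y) \<in> X"
    then obtain P where P: "is_min_poly (x, y) P"
      by (auto simp: X_def alg_int_points_def alg_int_point_def)
    \<comment> \<open>Uniqueness of the minimal polynomial transfers the degree and height of the
      point to the witness \<open>P\<close>.\<close>
    have deg: "degree P = n" and ht: "of_int (poly_height P) \<le> Q"
      using xy min_poly_eq[OF P]
      by (auto simp: X_def alg_int_points_def point_degree_def point_height_def)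
    have cf: "\<bar>of_int (coeff P i)\<bar> \<le> Q" for i
      using abs_coeff_le_poly_height[of P i] ht by linarith
    have root: "poly (map_poly of_int P) x = 0" "poly (map_poly of_int P) y = 0"
      and monic: "lead_coeff P = 1"
      using P by (auto simp: is_min_poly_def)
    have x: "\<bar>x - d1\<bar> \<le> l1 / 2" and y: "\<bar>y - d2\<bar> \<le> l2 / 2"
      using xy I by (auto simp: X_def)
    have "\<bar>poly (map_poly of_int P) d1\<bar> \<le> Q * real n * rho n d1 * \<bar>x - d1\<bar>"
      using x l by (intro abs_poly_le_of_near_root[OF deg cf root(1)]) auto
    also have "\<dots> \<le> H1"
      unfolding H_eq using x Q rho_ge_1[of n d1] by (intro mult_left_mono) auto
    finally have 1: "\<bar>poly (map_poly of_int P) d1\<bar> \<le> H1" .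
    have "\<bar>poly (map_poly of_int P) d2\<bar> \<le> Q * real n * rho n d2 * \<bar>y - d2\<bar>"
      using y l by (intro abs_poly_le_of_near_root[OF deg cf root(2)]) auto
    also have "\<dots> \<le> H2"
      unfolding H_eq using y Q rho_ge_1[of n d2] by (intro mult_left_mono) auto
    finally have 2: "\<bar>poly (map_poly of_int P) d2\<bar> \<le> H2" .
    have "P \<in> M"
      using 1 2 deg monic cf by (simp add: M_def monic_small_at_def)
    then show "(x, y) \<in> (\<Union>P\<in>M. Z P \<times> Z P)"
      using root by (auto simp: Z_def)
  qed
  have finU: "finite (\<Union>P\<in>M. Z P \<times> Z P)" using finM Z by auto
  then show "finite (alg_int_points n Q \<inter> (I1 \<times> I2))"
    using sub finite_subset by (auto simp: X_def)
  have "card X \<le> card (\<Union>P\<in>M. Z P \<times> Z P)" using sub finU by (rule card_mono[rotated])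
  also have "\<dots> \<le> (\<Sum>P\<in>M. card (Z P \<times> Z P))" using finM by (rule card_UN_le)
  also have "\<dots> \<le> (\<Sum>P\<in>M. n * n)"
    using Z by (intro sum_mono) (simp add: card_cartesian_product mult_le_mono)
  finally have "real (card X) \<le> real (card M) * (real n)\<^sup>2"
    by (simp add: power2_eq_square flip: of_nat_mult)
  also have "\<dots> \<le> (3 * Q) ^ (n - 2) * (24 * H1 * H2 / \<bar>d1 - d2\<bar>) * (real n)\<^sup>2"
    using cardM by (rule mult_right_mono) simp
  finally show "real (card (alg_int_points n Q \<inter> (I1 \<times> I2)))
           \<le> (3 * Q) ^ (n - 2) * (24 * H1 * H2 / \<bar>d1 - d2\<bar>) * (real n)\<^sup>2"
    by (simp add: X_def)
qed

section \<open>Comparison of constants and choice of the threshold\<close>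

lemma count_constant_less:
  assumes "n \<ge> 2"
  shows "(3::real) ^ (n - 2) * 6 * (real n)\<^sup>2 < 2 ^ (3 * n + 8)"
proof -
  \<comment> \<open>The count carries \<open>n ^ 4\<close>: one square from \<open>H1 * H2\<close>,
    one from the pairs of roots. Only one square appears in \<open>c7\<close>, so the other goes
    into the power of two.\<close>
  have "(3::real) ^ (n - 2) \<le> 4 ^ (n - 2)" by (rule power_mono) auto
  also have "\<dots> \<le> 4 ^ n" by (rule power_increasing) auto
  finally have "(3::real) ^ (n - 2) \<le> 2 ^ (2 * n)" by (simp add: power_mult)
  moreover have "(real n)\<^sup>2 \<le> 2 ^ (n + 1)"
    using square_le_two_power[of n] by (metis of_nat_le_iff of_nat_numeral of_nat_power)
  ultimately have "(3::real) ^ (n - 2) * 6 * (real n)\<^sup>2 \<le> 2 ^ (2 * n) * 6 * 2 ^ (n + 1)"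
    by (intro mult_mono) auto
  also have "\<dots> = 12 * 2 ^ (3 * n)" by (simp flip: power_add)
  also have "\<dots> < 2 ^ (3 * n + 8)" by (simp add: power_add)
  finally show ?thesis .
qed

theorem theorem2:
  fixes n :: nat and \<gamma>1 \<gamma>2 c6 d1 d2 :: real
  assumes "n \<ge> 2"
    and "0 < \<gamma>1" "\<gamma>1 < 1" "0 < \<gamma>2" "\<gamma>2 < 1"
    and "c6 > 0"
    and "d1 \<noteq> d2"
  shows "\<exists>Q0\<ge>1. \<forall>Q>Q0. \<forall>I1 I2.
           interval_centred d1 (c6 * Q powr (- \<gamma>1)) I1 \<longrightarrow>
           interval_centred d2 (c6 * Q powr (- \<gamma>2)) I2 \<longrightarrow>
             finite (alg_int_points n Q \<inter> (I1 \<times> I2)) \<and>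
             real (card (alg_int_points n Q \<inter> (I1 \<times> I2)))
               < c7 n d1 d2 * Q ^ n * measure lborel (I1 \<times> I2)"
proof -
  define H where "H \<gamma> d Q = Q * real n * rho n d * (c6 * Q powr (- \<gamma>) / 2)" for \<gamma> d Q :: real
  \<comment> \<open>One threshold for all size conditions: \<open>K \<le> H\<close> gives both
    \<open>1 \<le> H\<close> and \<open>\<bar>d1 - d2\<bar> \<le> 4 * H\<close>. It is eventually
    reached because \<open>H\<close> grows like \<open>Q powr (1 - \<gamma>)\<close> with
    \<open>\<gamma> < 1\<close>.\<close>
  define K where "K = max 1 \<bar>d1 - d2\<bar>"
  have ev: "eventually (\<lambda>Q. c6 * Q powr (- \<gamma>) \<le> 2 \<and> K \<le> H \<gamma> d Q) at_top"
    if \<gamma>: "0 < \<gamma>" "\<gamma> < 1" for \<gamma> d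
  proof -
    have "c6 * real n * rho n d / 2 > 0"
      using assms rho_ge_1[of n d] by simp
    then have "filterlim (\<lambda>Q. c6 * real n * rho n d / 2 * (Q * Q powr (- \<gamma>))) at_top at_top"
      using \<gamma> by real_asymp
    then have "filterlim (H \<gamma> d) at_top at_top"
      unfolding H_def by (simp add: mult_ac)
    then have "eventually (\<lambda>Q. K \<le> H \<gamma> d Q) at_top"
      by (simp add: filterlim_at_top)
    moreover have "((\<lambda>Q. c6 * Q powr (- \<gamma>)) \<longlongrightarrow> 0) at_top"
      using \<gamma> by real_asymp
    then have "eventually (\<lambda>Q. c6 * Q powr (- \<gamma>) < 2) at_top"
      by (rule order_tendstoD) simp
    ultimately show ?thesis by eventually_elim auto
  qed
  obtain N where N:
    "\<And>Q. Q \<ge> N \<Longrightarrow> c6 * Q powr (- \<gamma>1) \<le> 2 \<and> K \<le> H \<gamma>1 d1 Q"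
    "\<And>Q. Q \<ge> N \<Longrightarrow> c6 * Q powr (- \<gamma>2) \<le> 2 \<and> K \<le> H \<gamma>2 d2 Q"
    using eventually_conj[OF ev[OF assms(2,3)] ev[OF assms(4,5)]]
    unfolding eventually_at_top_linorder by blast
  show ?thesis
  proof (intro exI[of _ "max 1 N"] conjI allI impI)
    fix Q I1 I2
    assume Q: "max 1 N < Q"
      and I1: "interval_centred d1 (c6 * Q powr (- \<gamma>1)) I1"
      and I2: "interval_centred d2 (c6 * Q powr (- \<gamma>2)) I2"
    define l1 l2 where "l1 = c6 * Q powr (- \<gamma>1)" and "l2 = c6 * Q powr (- \<gamma>2)"
    define H1 H2 where "H1 = H \<gamma>1 d1 Q" and "H2 = H \<gamma>2 d2 Q"
    have pos: "l1 > 0" "l2 > 0" using Q assms by (auto simp: l1_def l2_def)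
    note D1 = interval_centredD[OF I1[folded l1_def] pos(1)]
    note D2 = interval_centredD[OF I2[folded l2_def] pos(2)]
    have H_eq: "H1 = Q * real n * rho n d1 * (l1 / 2)" "H2 = Q * real n * rho n d2 * (l2 / 2)"
      by (simp_all add: H1_def H2_def H_def l1_def l2_def)
    have large: "K \<le> H1" "K \<le> H2" "l1 \<le> 2" "l2 \<le> 2" "1 \<le> Q"
      using N[of Q] Q by (auto simp: H1_def H2_def l1_def l2_def)
    then have H: "1 \<le> H1" "1 \<le> H2" "\<bar>d1 - d2\<bar> \<le> 4 * H1" "\<bar>d1 - d2\<bar> \<le> 4 * H2"
      by (auto simp: K_def)
    note count = card_alg_int_points_le[OF assms(1) large(5) assms(7) H large(3,4) H_eq,
        of I1 I2, OF D1(3) D2(3)]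
    show "finite (alg_int_points n Q \<inter> (I1 \<times> I2))" by (rule count(1))
    \<comment> \<open>This is the claimed bound without its power of two. The two halves in
      \<open>H1\<close> and \<open>H2\<close> turn 24 into 6, and their two factors \<open>Q\<close>
      complete \<open>Q ^ (n - 2)\<close> to \<open>Q ^ n\<close>. Positivity of \<open>C\<close>
      makes the final inequality strict.\<close>
    define C where "C = (real n)\<^sup>2 * rho n d1 * rho n d2 / \<bar>d1 - d2\<bar> * Q ^ n * (l1 * l2)"
    have "C > 0"
      using assms pos large rho_ge_1[of n d1] rho_ge_1[of n d2] by (simp add: C_def)
    have "Q ^ n = Q ^ (n - 2) * Q\<^sup>2"
      using assms(1) by (simp only: power_add[symmetric] le_add_diff_inverse2)
    then have "(3 * Q) ^ (n - 2) * (24 * H1 * H2 / \<bar>d1 - d2\<bar>) * (real n)\<^sup>2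
        = (3 ^ (n - 2) * 6 * (real n)\<^sup>2) * C"
      by (simp add: H_eq C_def power_mult_distrib power2_eq_square)
    also have "\<dots> < 2 ^ (3 * n + 8) * C"
      using count_constant_less[OF assms(1)] \<open>C > 0\<close> by (rule mult_strict_right_mono)
    also have "\<dots> = c7 n d1 d2 * Q ^ n * measure lborel (I1 \<times> I2)"
      unfolding measure_lborel_Times[OF D1(1) D2(1)] D1(2) D2(2) c7_def C_def divide_inverse
      by (simp only: mult_ac)
    finally show "real (card (alg_int_points n Q \<inter> (I1 \<times> I2)))
        < c7 n d1 d2 * Q ^ n * measure lborel (I1 \<times> I2)"
      using count(2) by linarith
  qed simp
qed

end
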